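(* Let $p,q,r$ be distinct positive integers, $n=p+q+r$, and let $\alpha,\beta,\gamma$ be indeterminates. Let $y_0,\dots,y_{n-1}$ be independent indeterminates and define $y_m$ for $m\ge n$ by \[ y_{k+n}=\frac{\alpha\, y_{k+p}y_{k+n-p}+\beta\, y_{k+q}y_{k+n-q}+\gamma\, y_{k+r}y_{k+n-r}}{y_k}\qquad(k\ge 0). \] Then every $y_m$ is a Laurent polynomial in $y_0,\dots,y_{n-1}$ with coefficients in $\mathbb{Z}[\alpha,\beta,\gamma]$. *)

theory Defs
  imports
    "HOL-Library.Poly_Mapping"
    "HOL-Computational_Algebra.Polynomial"
    "HOL-Computational_Algebra.Fraction_Field"
begin

text \<open>The coefficient ring $\mathbf{Z}[\alpha,\beta,\gamma]$ is taken to be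
  $\mathbf{Z}[\alpha][\beta][\gamma]$, with \<open>\<alpha>\<close> the innermost variable.\<close>

type_synonym coeff_ring = "int poly poly poly"

text \<open>Polynomials in indeterminates $Y_0, Y_1, \ldots$ over the coefficient ring (an exponent
  vector is a finitely supported function), and their field of fractions. Only
  $Y_0,\ldots,Y_{n-1}$ are used for a given \<open>n\<close>; having one supply of variables for all \<open>n\<close>
  lets \<open>n\<close> be a term.\<close>

type_synonym poly_ring = "(nat \<Rightarrow>\<^sub>0 nat) \<Rightarrow>\<^sub>0 coeff_ring"

type_synonym ratfun = "poly_ring fract"

definition const :: "coeff_ring \<Rightarrow> ratfun" where
  "const c = Fract (Poly_Mapping.single 0 c) 1"

definition Y :: "nat \<Rightarrow> ratfun" where
  "Y i = Fract (Poly_Mapping.single (Poly_Mapping.single i 1) 1) 1"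

definition \<alpha> :: ratfun where
  "\<alpha> = const [:[:[:0, 1:]:]:]"

definition \<beta> :: ratfun where
  "\<beta> = const [:[:0, 1:]:]"

definition \<gamma> :: ratfun where
  "\<gamma> = const [:0, 1:]"

text \<open>Laurent polynomials in $Y_0,\ldots,Y_{n-1}$ over the coefficient ring: finite linear
  combinations of monomials with integer exponents.\<close>

definition laurent_polynomial :: "nat \<Rightarrow> ratfun \<Rightarrow> bool" where
  "laurent_polynomial n f \<longleftrightarrow>
    (\<exists>(E :: (nat \<Rightarrow> int) set) (c :: (nat \<Rightarrow> int) \<Rightarrow> coeff_ring).
       finite E \<and> f = (\<Sum>e\<in>E. const (c e) * (\<Prod>i<n. Y i powi e i)))"

end

theory Submission
  imports Defs
begin

text \<open>
  Let \<open>L\<close> be the Laurent polynomial ring in \<open>Y\<^sub>0, \<dots>, Y\<^sub>n\<^sub>-\<^sub>1\<close>. By induction,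
  \<open>y\<^sub>m\<close> is a Laurent polynomial in \<open>y\<^sub>1, \<dots>, y\<^sub>n\<close> and also one in
  \<open>y\<^sub>n\<^sub>+\<^sub>1, \<dots>, y\<^sub>2\<^sub>n\<close>. The first fact gives \<open>y\<^sub>m \<in> L[1/y\<^sub>n]\<close>, so only a pole along
  \<open>y\<^sub>n = 0\<close> has to be excluded. For this the second fact suffices as soon as
  \<open>y\<^sub>n\<^sub>+\<^sub>1, \<dots>, y\<^sub>2\<^sub>n\<close> are units in the local ring of a point with \<open>y\<^sub>n = 0\<close>. Such a point is
  given by the solution \<open>y\<^sub>m = m - n\<close> of the recurrence (with suitable rational parameters);
  although \<open>y\<^sub>2\<^sub>n\<close> is defined by a division by \<open>y\<^sub>n\<close>, it is regular there because
  the numerator is a multiple of \<open>y\<^sub>n\<close> (singularity confinement). The element \<open>y\<^sub>n\<close> is prime in \<open>L\<close>: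
  it is linear in \<open>\<alpha>\<close> with a unit as leading coefficient, so that \<open>L/(y\<^sub>n)\<close> is obtained by
  solving for \<open>\<alpha>\<close>.
\<close>

subsection \<open>Ring homomorphisms\<close>

definition is_ring_hom :: "('a::comm_ring_1 \<Rightarrow> 'b::comm_ring_1) \<Rightarrow> bool" where
  "is_ring_hom h \<longleftrightarrow> h 0 = 0 \<and> h 1 = 1 \<and>
     (\<forall>x y. h (x + y) = h x + h y) \<and> (\<forall>x y. h (x * y) = h x * h y)"

lemma is_ring_homD:
  assumes "is_ring_hom h"
  shows "h 0 = 0" and "h 1 = 1" and "h (x + y) = h x + h y" and "h (x * y) = h x * h y"
  using assms by (auto simp: is_ring_hom_def)

lemma is_ring_hom_minus:
  assumes "is_ring_hom h"
  shows "h (- x) = - h x"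
  using is_ring_homD(3)[OF assms, of x "- x"] is_ring_homD(1)[OF assms]
  by (simp add: eq_neg_iff_add_eq_0 add.commute)

lemma ring_hom_poly_extension:
  assumes h: "is_ring_hom h"
  obtains H where "is_ring_hom H" and "\<And>c. H [:c:] = h c" and "H [:0, 1:] = x"
proof
  note hs = is_ring_homD[OF h]
  let ?H = "\<lambda>p. poly (map_poly h p) x"
  have add: "?H (p + q) = ?H p + ?H q" for p q
  proof -
    have "map_poly h (p + q) = map_poly h p + map_poly h q"
      by (rule poly_eqI) (simp add: coeff_map_poly hs)
    then show ?thesis by simp
  qed
  have pC: "?H (pCons a p) = h a + x * ?H p" for a p
    by (simp add: map_poly_pCons hs)
  have sm: "?H (smult a p) = h a * ?H p" for a p
    by (simp add: map_poly_smult hs)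
  have mult: "?H (p * q) = ?H p * ?H q" for p q
    by (induction p) (simp_all add: add pC sm hs algebra_simps)
  show "is_ring_hom ?H"
    unfolding is_ring_hom_def using add mult by (auto simp: hs)
  show "?H [:c:] = h c" for c
    by (simp add: pC)
  show "?H [:0, 1:] = x"
    by (simp add: pC hs)
qed

lemma poly_mapping_eq_sum_single:
  "P = (\<Sum>m\<in>Poly_Mapping.keys P. Poly_Mapping.single m (Poly_Mapping.lookup P m))"
  by (rule poly_mapping_eqI)
     (auto simp: lookup_sum lookup_single when_def in_keys_iff sum.delta)

lemma ring_hom_poly_mapping_extension:
  fixes h :: "'c::comm_ring_1 \<Rightarrow> 'b::comm_ring_1" and \<mu> :: "'m::comm_monoid_add \<Rightarrow> 'b"
  assumes h: "is_ring_hom h" and \<mu>0: "\<mu> 0 = 1" and \<mu>add: "\<And>m m'. \<mu> (m + m') = \<mu> m * \<mu> m'"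
  obtains H :: "('m \<Rightarrow>\<^sub>0 'c) \<Rightarrow> 'b"
  where "is_ring_hom H" and "\<And>m c. H (Poly_Mapping.single m c) = h c * \<mu> m"
proof -
  note hs = is_ring_homD[OF h]
  define H :: "('m \<Rightarrow>\<^sub>0 'c) \<Rightarrow> 'b" where "H = (\<lambda>P. \<Sum>m\<in>Poly_Mapping.keys P. h (Poly_Mapping.lookup P m) * \<mu> m)"
  have H_eq: "H P = (\<Sum>m\<in>Poly_Mapping.keys P. h (Poly_Mapping.lookup P m) * \<mu> m)" for P
    by (simp add: H_def)
  have add: "H (P + Q) = H P + H Q" for P Q
    unfolding H_def by (rule setsum_keys_plus_distrib) (simp_all add: hs distrib_right)
  have H0: "H 0 = 0"
    by (simp add: H_def)
  have single: "H (Poly_Mapping.single m c) = h c * \<mu> m" for m c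
    by (simp add: H_def hs)
  have sum: "H (sum f A) = (\<Sum>x\<in>A. H (f x))" for f :: "'z \<Rightarrow> _" and A
    by (induction A rule: infinite_finite_induct) (simp_all add: add H0)
  have mult: "H (P * Q) = H P * H Q" for P Q
  proof -
    let ?s = "\<lambda>m m'. Poly_Mapping.single (m + m')
                (Poly_Mapping.lookup P m * Poly_Mapping.lookup Q m')"
    have "P * Q = (\<Sum>m\<in>Poly_Mapping.keys P. Poly_Mapping.single m (Poly_Mapping.lookup P m)) *
                  (\<Sum>m\<in>Poly_Mapping.keys Q. Poly_Mapping.single m (Poly_Mapping.lookup Q m))"
      using poly_mapping_eq_sum_single[of P] poly_mapping_eq_sum_single[of Q] by simp
    also have "\<dots> = (\<Sum>m\<in>Poly_Mapping.keys P. \<Sum>m'\<in>Poly_Mapping.keys Q. ?s m m')"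
      by (simp add: sum_product mult_single)
    finally have "H (P * Q) = H (\<Sum>m\<in>Poly_Mapping.keys P. \<Sum>m'\<in>Poly_Mapping.keys Q. ?s m m')"
      by (rule arg_cong)
    also have "\<dots> = (\<Sum>m\<in>Poly_Mapping.keys P. \<Sum>m'\<in>Poly_Mapping.keys Q. H (?s m m'))"
      by (simp only: sum)
    also have "\<dots> = H P * H Q"
      by (simp add: single sum_product hs \<mu>add mult_ac H_eq[of P] H_eq[of Q])
    finally show ?thesis .
  qed
  have one: "H 1 = 1"
    using single[of 0 1] by (simp only: single_one hs \<mu>0 mult_1)
  have "is_ring_hom H"
    unfolding is_ring_hom_def using add mult one H0 by blast
  then show thesis
    using single by (rule that)
qed

lemma ring_hom_evaluation:
  fixes a b c :: "'k::field" and x :: "nat \<Rightarrow> 'k"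
  obtains H :: "poly_ring \<Rightarrow> 'k"
  where "is_ring_hom H"
    and "H (Poly_Mapping.single 0 [:[:[:0, 1:]:]:]) = a"
    and "H (Poly_Mapping.single 0 [:[:0, 1:]:]) = b"
    and "H (Poly_Mapping.single 0 [:0, 1:]) = c"
    and "\<And>i. H (Poly_Mapping.single (Poly_Mapping.single i 1) 1) = x i"
proof -
  have "is_ring_hom (of_int :: int \<Rightarrow> 'k)"
    by (simp add: is_ring_hom_def)
  then obtain h1 :: "int poly \<Rightarrow> 'k" where h1: "is_ring_hom h1" "h1 [:0, 1:] = a"
    by (rule ring_hom_poly_extension) blast
  from h1(1) obtain h2 where h2: "is_ring_hom h2" "\<And>c. h2 [:c:] = h1 c" "h2 [:0, 1:] = b"
    by (rule ring_hom_poly_extension) blast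
  from h2(1) obtain h3 where h3: "is_ring_hom h3" "\<And>c. h3 [:c:] = h2 c" "h3 [:0, 1:] = c"
    by (rule ring_hom_poly_extension) blast
  let ?\<mu> = "\<lambda>m. \<Prod>i\<in>Poly_Mapping.keys m. x i ^ Poly_Mapping.lookup m i"
  have \<mu>_mono: "?\<mu> m = (\<Prod>i\<in>A. x i ^ Poly_Mapping.lookup m i)"
    if "Poly_Mapping.keys m \<subseteq> A" "finite A" for m A
    by (rule prod.mono_neutral_left) (use that in \<open>auto simp: in_keys_iff\<close>)
  have \<mu>_add: "?\<mu> (m + m') = ?\<mu> m * ?\<mu> m'" for m m'
  proof -
    let ?A = "Poly_Mapping.keys m \<union> Poly_Mapping.keys m'"
    have "?\<mu> (m + m') = (\<Prod>i\<in>?A. x i ^ Poly_Mapping.lookup (m + m') i)"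
      by (rule \<mu>_mono) (use keys_add[of m m'] in auto)
    also have "\<dots> = (\<Prod>i\<in>?A. x i ^ Poly_Mapping.lookup m i) * (\<Prod>i\<in>?A. x i ^ Poly_Mapping.lookup m' i)"
      by (simp add: lookup_add power_add prod.distrib)
    also have "\<dots> = ?\<mu> m * ?\<mu> m'"
      using \<mu>_mono[of m ?A] \<mu>_mono[of m' ?A] by simp
    finally show ?thesis .
  qed
  obtain H :: "poly_ring \<Rightarrow> 'k" where
    H: "is_ring_hom H" "\<And>m c. H (Poly_Mapping.single m c) = h3 c * ?\<mu> m"
    by (rule ring_hom_poly_mapping_extension[OF h3(1), of ?\<mu>]) (use \<mu>_add in auto)
  show ?thesis
    by (rule that[of H]) (simp_all add: H h1 h2 h3 is_ring_homD(2)[OF h3(1)])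
qed

subsection \<open>Laurent polynomials as a generated ring\<close>

text \<open>A property that respects sums and products only has to be checked on the generators
  here, which the explicit expansion in \<open>laurent_polynomial\<close> does not offer
  directly.\<close>

inductive_set ring_gen :: "'a::comm_ring_1 set \<Rightarrow> 'a set" for G where
  one: "1 \<in> ring_gen G"
| minus_one: "-1 \<in> ring_gen G"
| gen: "g \<in> G \<Longrightarrow> g \<in> ring_gen G"
| add: "f \<in> ring_gen G \<Longrightarrow> g \<in> ring_gen G \<Longrightarrow> f + g \<in> ring_gen G"
| mult: "f \<in> ring_gen G \<Longrightarrow> g \<in> ring_gen G \<Longrightarrow> f * g \<in> ring_gen G"

lemma ring_gen_mono:
  assumes "G \<subseteq> G'" and "f \<in> ring_gen G"
  shows "f \<in> ring_gen G'"
  using assms(2) by induction (use assms(1) in \<open>auto intro: ring_gen.intros\<close>)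

lemma ring_gen_zero: "0 \<in> ring_gen G"
  using ring_gen.add[OF ring_gen.one ring_gen.minus_one] by simp

lemma ring_gen_minus: "f \<in> ring_gen G \<Longrightarrow> - f \<in> ring_gen G"
  using ring_gen.mult[OF ring_gen.minus_one] by fastforce

lemma ring_gen_diff: "f \<in> ring_gen G \<Longrightarrow> g \<in> ring_gen G \<Longrightarrow> f - g \<in> ring_gen G"
  using ring_gen.add[OF _ ring_gen_minus, of f G g] by simp

lemma ring_gen_power: "f \<in> ring_gen G \<Longrightarrow> f ^ k \<in> ring_gen G"
  by (induction k) (auto intro: ring_gen.intros)

lemmas ring_gen_intros = ring_gen.one ring_gen.add ring_gen.mult ring_gen_zero
  ring_gen_minus ring_gen_diff ring_gen_power

text \<open>Two index sets matter: \<open>{..<n}\<close> for the theorem, and \<open>UNIV\<close>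
  for denominators of arbitrary fractions, which may contain any variable.\<close>

definition laurent_gens :: "nat set \<Rightarrow> ratfun set" where
  "laurent_gens I = {\<alpha>, \<beta>, \<gamma>} \<union> Y ` I \<union> (\<lambda>i. inverse (Y i)) ` I"

abbreviation laurent_ring :: "nat set \<Rightarrow> ratfun set" where
  "laurent_ring I \<equiv> ring_gen (laurent_gens I)"

lemma laurent_gens_mem:
  "\<alpha> \<in> laurent_ring I" "\<beta> \<in> laurent_ring I" "\<gamma> \<in> laurent_ring I"
  "i \<in> I \<Longrightarrow> Y i \<in> laurent_ring I" "i \<in> I \<Longrightarrow> inverse (Y i) \<in> laurent_ring I"
  by (auto simp: laurent_gens_def intro: ring_gen.gen)

lemma Y_nonzero: "Y i \<noteq> 0"
proof -
  have "Poly_Mapping.single (Poly_Mapping.single i (1::nat)) (1::coeff_ring) \<noteq> 0"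
    by (metis lookup_single_eq lookup_zero one_neq_zero)
  then show ?thesis
    by (simp add: Y_def Zero_fract_def eq_fract)
qed

lemma const_hom: "is_ring_hom const"
  by (auto simp: is_ring_hom_def const_def Zero_fract_def One_fract_def single_add mult_single)

text \<open>The nested coefficients are built outwards: integers, then polynomials in \<alpha>, then
  \<beta>, then \<gamma>.\<close>

lemma const_mem_laurent_ring: "const c \<in> laurent_ring I"
proof -
  note cs = is_ring_homD[OF const_hom]
  have int: "const [:[:[:k:]:]:] \<in> laurent_ring I" for k
  proof -
    have nat: "const [:[:[:int j:]:]:] \<in> laurent_ring I" for j
    proof (induction j)
      case 0
      then show ?case by (simp add: cs ring_gen_zero)
    next
      case (Suc j)
      have "[:[:[:int (Suc j):]:]:] = 1 + [:[:[:int j:]:]:]"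
        by (simp add: one_pCons)
      then show ?case using Suc by (simp only: cs ring_gen.add ring_gen.one)
    qed
    show ?thesis
    proof (cases k)
      case (nonneg j)
      then show ?thesis using nat by simp
    next
      case (neg j)
      have "[:[:[:k:]:]:] = - [:[:[:int (Suc j):]:]:]"
        using neg by simp
      then show ?thesis using nat[of "Suc j"]
        by (simp only: is_ring_hom_minus[OF const_hom] ring_gen_minus)
    qed
  qed
  have 1: "const [:[:u:]:] \<in> laurent_ring I" for u
  proof (induction u)
    case (pCons k u)
    have "[:[:pCons k u:]:] = [:[:[:k:]:]:] + [:[:[:0, 1:]:]:] * [:[:u:]:]" by simp
    then show ?case using pCons int[of k] laurent_gens_mem(1)
      by (simp only: cs \<alpha>_def ring_gen.add ring_gen.mult)
  qed (simp add: cs ring_gen_zero)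
  have 2: "const [:u:] \<in> laurent_ring I" for u
  proof (induction u)
    case (pCons k u)
    have "[:pCons k u:] = [:[:k:]:] + [:[:0, 1:]:] * [:u:]" by simp
    then show ?case using pCons 1[of k] laurent_gens_mem(2)
      by (simp only: cs \<beta>_def ring_gen.add ring_gen.mult)
  qed (simp add: cs ring_gen_zero)
  show ?thesis
  proof (induction c)
    case (pCons k u)
    have "pCons k u = [:k:] + [:0, 1:] * u" by simp
    then show ?case using pCons 2[of k] laurent_gens_mem(3)
      by (simp only: cs \<gamma>_def ring_gen.add ring_gen.mult)
  qed (simp add: cs ring_gen_zero)
qed


lemma Fract_mem_laurent_ring: "Fract P 1 \<in> laurent_ring UNIV"
proof -
  have add: "Fract (P + Q) 1 = Fract P 1 + Fract Q 1" for P Q :: poly_ring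
    by simp
  have var: "Fract (Poly_Mapping.single (Poly_Mapping.single i k) 1) 1 = Y i ^ k" for i k
  proof (induction k)
    case (Suc k)
    have "Fract (Poly_Mapping.single (Poly_Mapping.single i (Suc k)) 1) 1 =
          Y i * Fract (Poly_Mapping.single (Poly_Mapping.single i k) (1::coeff_ring)) 1"
      by (simp add: Y_def mult_single flip: single_add)
    with Suc show ?case by simp
  qed (simp add: One_fract_def)
  have mono: "Fract (Poly_Mapping.single m 1) 1 \<in> laurent_ring UNIV" for m
  proof -
    have "Fract (Poly_Mapping.single (\<Sum>i\<in>A. Poly_Mapping.single i (Poly_Mapping.lookup m i)) 1) 1
            \<in> laurent_ring UNIV" if "finite A" for A
      using that
    proof (induction A)
      case (insert i A)
      let ?M = "\<lambda>m. Fract (Poly_Mapping.single m (1::coeff_ring)) 1"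
      have M_add: "?M (m1 + m2) = ?M m1 * ?M m2" for m1 m2 :: "nat \<Rightarrow>\<^sub>0 nat"
        by (simp add: mult_single)
      show ?case using insert(3)
        unfolding sum.insert[OF insert(1,2)] M_add var by (auto intro!: ring_gen_intros laurent_gens_mem)
    qed (simp add: ring_gen.one flip: One_fract_def)
    from this[OF finite_keys, of m] show ?thesis
      using poly_mapping_eq_sum_single[of m] by simp
  qed
  have single: "Fract (Poly_Mapping.single m c) 1 \<in> laurent_ring UNIV" for m c
  proof -
    have "Fract (Poly_Mapping.single m c) 1 = const c * Fract (Poly_Mapping.single m 1) 1"
      by (simp add: const_def mult_single)
    then show ?thesis
      using const_mem_laurent_ring mono by (simp add: ring_gen.mult)
  qed
  have "Fract (\<Sum>m\<in>A. Poly_Mapping.single m (Poly_Mapping.lookup P m)) 1 \<in> laurent_ring UNIV"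
    if "finite A" for A
    using that
  proof (induction A)
    case (insert m A)
    then show ?case
      unfolding sum.insert[OF insert(1,2)] add by (intro ring_gen.add single insert)
  qed (simp add: ring_gen_zero flip: Zero_fract_def)
  from this[OF finite_keys, of P] show ?thesis
    using poly_mapping_eq_sum_single[of P] by simp
qed

lemma laurent_polynomial_mono: "laurent_polynomial n (const c * (\<Prod>i<n. Y i powi e i))"
  unfolding laurent_polynomial_def by (rule exI[of _ "{e}"]) auto

lemma laurent_polynomial_add:
  assumes "laurent_polynomial n f" and "laurent_polynomial n g"
  shows "laurent_polynomial n (f + g)"
proof -
  obtain E c E' c' where *: "finite E" "f = (\<Sum>e\<in>E. const (c e) * (\<Prod>i<n. Y i powi e i))"
    "finite E'" "g = (\<Sum>e\<in>E'. const (c' e) * (\<Prod>i<n. Y i powi e i))"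
    using assms unfolding laurent_polynomial_def by blast
  define d where "d e = (if e \<in> E then c e else 0) + (if e \<in> E' then c' e else 0)" for e
  have "f = (\<Sum>e\<in>E \<union> E'. const (if e \<in> E then c e else 0) * (\<Prod>i<n. Y i powi e i))"
    unfolding *(2) by (rule sum.mono_neutral_cong_left)
      (use * in \<open>auto simp: is_ring_homD[OF const_hom]\<close>)
  moreover have "g = (\<Sum>e\<in>E \<union> E'. const (if e \<in> E' then c' e else 0) * (\<Prod>i<n. Y i powi e i))"
    unfolding *(4) by (rule sum.mono_neutral_cong_left)
      (use * in \<open>auto simp: is_ring_homD[OF const_hom]\<close>)
  ultimately have "f + g = (\<Sum>e\<in>E \<union> E'. const (d e) * (\<Prod>i<n. Y i powi e i))"
    by (simp add: d_def is_ring_homD[OF const_hom] distrib_right sum.distrib)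
  with * show ?thesis
    unfolding laurent_polynomial_def by blast
qed

lemma laurent_polynomial_sum:
  assumes "\<And>x. x \<in> A \<Longrightarrow> laurent_polynomial n (f x)"
  shows "laurent_polynomial n (\<Sum>x\<in>A. f x)"
proof -
  have "laurent_polynomial n 0"
    using laurent_polynomial_mono[of n 0] by (simp add: is_ring_homD[OF const_hom])
  then show ?thesis
    using assms by (induction A rule: infinite_finite_induct) (auto intro: laurent_polynomial_add)
qed

lemma laurent_polynomial_mult:
  assumes "laurent_polynomial n f" and "laurent_polynomial n g"
  shows "laurent_polynomial n (f * g)"
proof -
  obtain E c E' c' where *: "f = (\<Sum>e\<in>E. const (c e) * (\<Prod>i<n. Y i powi e i))"
    "g = (\<Sum>e\<in>E'. const (c' e) * (\<Prod>i<n. Y i powi e i))"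
    using assms unfolding laurent_polynomial_def by blast
  have "const (c e) * (\<Prod>i<n. Y i powi e i) * (const (c' e') * (\<Prod>i<n. Y i powi e' i)) =
        const (c e * c' e') * (\<Prod>i<n. Y i powi (e i + e' i))" for e e'
    by (simp add: is_ring_homD[OF const_hom] power_int_add Y_nonzero prod.distrib)
  \<comment> \<open>Different pairs can give the same exponent vector, so the products are added as
    one-term Laurent polynomials and no terms are collected here.\<close>
  then have "f * g = (\<Sum>e\<in>E. \<Sum>e'\<in>E'. const (c e * c' e') * (\<Prod>i<n. Y i powi (e i + e' i)))"
    unfolding * by (simp add: sum_product)
  then show ?thesis
    by (simp only:) (intro laurent_polynomial_sum laurent_polynomial_mono)
qed

lemma laurent_ring_imp_laurent_polynomial:
  assumes "f \<in> laurent_ring {..<n}"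
  shows "laurent_polynomial n f"
proof -
  have const: "laurent_polynomial n (const c)" for c
    using laurent_polynomial_mono[of n c "\<lambda>_. 0"] by simp
  have Y: "laurent_polynomial n (Y i powi k)" if "i < n" for i k
  proof -
    have "(\<Prod>j<n. Y j powi (if j = i then k else 0)) = (\<Prod>j<n. if j = i then Y j powi k else 1)"
      by (rule prod.cong) auto
    also have "\<dots> = Y i powi k"
      using that by (simp add: prod.delta)
    finally show ?thesis
      using laurent_polynomial_mono[of n 1 "\<lambda>j. if j = i then k else 0"]
      by (simp add: is_ring_homD[OF const_hom])
  qed
  from assms show ?thesis
  proof induction
    case one
    then show ?case using const[of 1] by (simp add: is_ring_homD[OF const_hom])
  next
    case minus_one
    then show ?case using const[of "- 1"]
      by (simp add: is_ring_homD[OF const_hom] is_ring_hom_minus[OF const_hom])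
  next
    case (gen g)
    then show ?case
      using const Y[of _ 1] Y[of _ "- 1"]
      by (auto simp: laurent_gens_def \<alpha>_def \<beta>_def \<gamma>_def power_int_minus)
  qed (auto intro: laurent_polynomial_add laurent_polynomial_mult)
qed


subsection \<open>Values of rational functions at a point\<close>

text \<open>A point is a ring homomorphism \<open>H\<close>; \<open>f\<close> specializes to some value iff it lies in the
  localization of the polynomial ring at the kernel of \<open>H\<close>.\<close>

definition specializes :: "(poly_ring \<Rightarrow> 'k::field) \<Rightarrow> ratfun \<Rightarrow> 'k \<Rightarrow> bool" where
  "specializes H f v \<longleftrightarrow> (\<exists>P Q. f = Fract P Q \<and> H Q \<noteq> 0 \<and> v = H P / H Q)"

lemma specializesI: "H Q \<noteq> 0 \<Longrightarrow> specializes H (Fract P Q) (H P / H Q)"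
  by (auto simp: specializes_def)

lemma specializes_Fract_1:
  assumes "is_ring_hom H"
  shows "specializes H (Fract P 1) (H P)"
  using specializesI[of H 1 P] is_ring_homD[OF assms] by simp

lemma specializes_unique:
  assumes H: "is_ring_hom H" and "specializes H f v" and "specializes H f w"
  shows "v = w"
proof -
  obtain P Q P' Q' where *: "f = Fract P Q" "H Q \<noteq> 0" "v = H P / H Q"
    "f = Fract P' Q'" "H Q' \<noteq> 0" "w = H P' / H Q'"
    using assms(2,3) unfolding specializes_def by blast
  then have "Q \<noteq> 0" "Q' \<noteq> 0"
    using is_ring_homD[OF H] by auto
  with * have "P * Q' = P' * Q"
    by (simp add: eq_fract)
  then have "H P * H Q' = H P' * H Q"
    using is_ring_homD[OF H] by metis
  with * show ?thesis by (simp add: frac_eq_eq)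
qed

lemma specializes_add:
  assumes H: "is_ring_hom H" and "specializes H f v" and "specializes H g w"
  shows "specializes H (f + g) (v + w)"
proof -
  obtain P Q P' Q' where *: "f = Fract P Q" "H Q \<noteq> 0" "v = H P / H Q"
    "g = Fract P' Q'" "H Q' \<noteq> 0" "w = H P' / H Q'"
    using assms(2,3) unfolding specializes_def by blast
  then have "Q \<noteq> 0" "Q' \<noteq> 0"
    using is_ring_homD[OF H] by auto
  with * have "f + g = Fract (P * Q' + P' * Q) (Q * Q')"
    by simp
  moreover have "v + w = H (P * Q' + P' * Q) / H (Q * Q')"
    using * by (simp add: is_ring_homD[OF H] field_simps)
  ultimately show ?thesis
    using * specializesI[of H "Q * Q'" "P * Q' + P' * Q"]
    by (simp only: is_ring_homD[OF H] mult_eq_0_iff) simp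
qed

lemma specializes_mult:
  assumes H: "is_ring_hom H" and "specializes H f v" and "specializes H g w"
  shows "specializes H (f * g) (v * w)"
proof -
  obtain P Q P' Q' where *: "f = Fract P Q" "H Q \<noteq> 0" "v = H P / H Q"
    "g = Fract P' Q'" "H Q' \<noteq> 0" "w = H P' / H Q'"
    using assms(2,3) unfolding specializes_def by blast
  then show ?thesis
    using specializesI[of H "Q * Q'" "P * P'"] by (simp add: is_ring_homD[OF H])
qed

lemma specializes_inverse:
  assumes "specializes H f v" and "v \<noteq> 0"
  shows "specializes H (inverse f) (inverse v)"
proof -
  obtain P Q where *: "f = Fract P Q" "H Q \<noteq> 0" "v = H P / H Q"
    using assms(1) by (auto simp: specializes_def)
  then show ?thesis
    using specializesI[of H P Q] assms(2) by simp
qed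

lemma specializes_one: "is_ring_hom H \<Longrightarrow> specializes H 1 1"
  using specializes_Fract_1[of H 1] by (simp add: is_ring_homD flip: One_fract_def)

lemma specializes_minus:
  assumes H: "is_ring_hom H" and "specializes H f v"
  shows "specializes H (- f) (- v)"
proof -
  have "specializes H (Fract (- 1) 1) (- 1)"
    using specializes_Fract_1[OF H, of "- 1"]
    by (simp only: is_ring_hom_minus[OF H] is_ring_homD[OF H])
  then have "specializes H (- 1) (- 1)"
    by (simp add: One_fract_def)
  from specializes_mult[OF H this assms(2)] show ?thesis by simp
qed

lemma specializes_divide:
  assumes "is_ring_hom H" and "specializes H f v" and "specializes H g w" and "w \<noteq> 0"
  shows "specializes H (f / g) (v / w)"
  using specializes_mult[OF assms(1,2) specializes_inverse[OF assms(3,4)]]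
  by (simp add: divide_inverse)

lemma specializes_diff:
  assumes "is_ring_hom H" and "specializes H f v" and "specializes H g w"
  shows "specializes H (f - g) (v - w)"
  using specializes_add[OF assms(1,2) specializes_minus[OF assms(1,3)]] by simp

lemma specializes_power:
  assumes "is_ring_hom H" and "specializes H f v"
  shows "specializes H (f ^ k) (v ^ k)"
  by (induction k) (auto intro: specializes_one specializes_mult assms)

lemmas specializes_intros =
  specializes_add specializes_mult specializes_divide specializes_diff specializes_power

text \<open>Control over the ring of values is what \<open>shift_mem\<close> needs; with
  \<open>G' = UNIV\<close> only the existence of a value remains, as in
  \<open>linear_point\<close>.\<close>

lemma specializes_ring_gen:
  assumes H: "is_ring_hom H" and "f \<in> ring_gen G"
    and gens: "\<And>g. g \<in> G \<Longrightarrow> \<exists>v\<in>ring_gen G'. specializes H g v"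
  shows "\<exists>v\<in>ring_gen G'. specializes H f v"
  using assms(2)
proof induction
  case one
  then show ?case using specializes_one[OF H] ring_gen.one by blast
next
  case minus_one
  then show ?case using specializes_minus[OF H specializes_one[OF H]] ring_gen.minus_one by blast
next
  case (gen g)
  then show ?case by (rule gens)
next
  case (add f g)
  then show ?case using specializes_add[OF H] ring_gen.add by blast
next
  case (mult f g)
  then show ?case using specializes_mult[OF H] ring_gen.mult by blast
qed

text \<open>The indeterminates are free, so their values are arbitrary. Over the rationals this
  gives numerical points; over \<open>ratfun\<close> itself it gives substitutions.\<close>

lemma ring_hom_point:
  fixes a b c :: "'k::field" and x :: "nat \<Rightarrow> 'k"
  obtains H where "is_ring_hom H" and "specializes H \<alpha> a" and "specializes H \<beta> b"
    and "specializes H \<gamma> c" and "\<And>i. specializes H (Y i) (x i)"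
proof -
  obtain H :: "poly_ring \<Rightarrow> 'k" where "is_ring_hom H"
    and "H (Poly_Mapping.single 0 [:[:[:0, 1:]:]:]) = a"
    and "H (Poly_Mapping.single 0 [:[:0, 1:]:]) = b"
    and "H (Poly_Mapping.single 0 [:0, 1:]) = c"
    and "\<And>i. H (Poly_Mapping.single (Poly_Mapping.single i 1) 1) = x i"
    by (rule ring_hom_evaluation[of a b c x], rule that)
  then show ?thesis
    by (intro that[of H])
       (metis specializes_Fract_1 \<alpha>_def \<beta>_def \<gamma>_def const_def Y_def)+
qed

subsection \<open>The Gale--Robinson sequence\<close>

text \<open>The names stand for \<open>d = y\<^sub>n\<close>, \<open>bp = y\<^sub>p\<close>, \<open>cp = y\<^sub>n\<^sub>-\<^sub>p\<close>, \<open>Bp = y\<^sub>n\<^sub>+\<^sub>p\<close>, \<open>Cp = y\<^sub>2\<^sub>n\<^sub>-\<^sub>p\<close>,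
  \<open>sp = y\<^sub>2\<^sub>p\<close>, \<open>tp = y\<^sub>2\<^sub>n\<^sub>-\<^sub>2\<^sub>p\<close>, \<open>upq = y\<^sub>n\<^sub>+\<^sub>p\<^sub>-\<^sub>q\<close> and \<open>E = y\<^sub>2\<^sub>n\<close>. The conclusion expresses \<open>E\<close> without
  dividing by \<open>d\<close>.\<close>

lemma confinement_identity:
  fixes d :: "'a::field"
  assumes "d \<noteq> 0"
    and F: "d * y0 = a * bp * cp + b * bq * cq + c * br * cr"
    and Bp: "Bp * bp = a * sp * d + b * cr * upq + c * cq * upr"
    and Bq: "Bq * bq = a * cr * uqp + b * sq * d + c * cp * uqr"
    and Br: "Br * br = a * cq * urp + b * cp * urq + c * sr * d"
    and Cp: "Cp * cp = a * d * tp + b * uqp * Br + c * urp * Bq"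
    and Cq: "Cq * cq = a * upq * Br + b * d * tq + c * urq * Bp"
    and Cr: "Cr * cr = a * upr * Bq + b * uqr * Bp + c * d * tr"
    and E: "E * d = a * Bp * Cp + b * Bq * Cq + c * Br * Cr"
  shows "E * (cp * cq * cr) = Bp * Bq * Br * y0
    + a\<^sup>2 * (Bp * cq * cr * tp - Bq * Br * cp * sp)
    + b\<^sup>2 * (Bq * cp * cr * tq - Bp * Br * cq * sq)
    + c\<^sup>2 * (Br * cp * cq * tr - Bp * Bq * cr * sr)" (is "_ = ?R")
proof -
  have "d * (E * (cp * cq * cr)) = (E * d) * (cp * cq * cr)"
    by simp
  also have "\<dots> = a * Bp * (Cp * cp) * cq * cr + b * Bq * (Cq * cq) * cp * cr
      + c * Br * (Cr * cr) * cp * cq"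
    unfolding E by (simp add: algebra_simps)
  \<comment> \<open>Six terms are free of \<open>d\<close>. Grouped by the pair of
    \<open>Bp\<close>, \<open>Bq\<close>, \<open>Br\<close> that they contain, they form the right
    sides of the equations for \<open>Bp\<close>, \<open>Bq\<close>, \<open>Br\<close> without the
    \<open>d\<close>-terms.\<close>
  also have "\<dots> = a * Bq * Br * cp * (Bp * bp - a * sp * d) + b * Bp * Br * cq * (Bq * bq - b * sq * d)
      + c * Bp * Bq * cr * (Br * br - c * sr * d)
      + d * (a\<^sup>2 * Bp * cq * cr * tp + b\<^sup>2 * Bq * cp * cr * tq + c\<^sup>2 * Br * cp * cq * tr)"
    unfolding Bp Bq Br Cp Cq Cr by (simp add: algebra_simps power2_eq_square)
  also have "\<dots> = Bp * Bq * Br * (a * bp * cp + b * bq * cq + c * br * cr)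
      - d * (a\<^sup>2 * Bq * Br * cp * sp + b\<^sup>2 * Bp * Br * cq * sq + c\<^sup>2 * Bp * Bq * cr * sr)
      + d * (a\<^sup>2 * Bp * cq * cr * tp + b\<^sup>2 * Bq * cp * cr * tq + c\<^sup>2 * Br * cp * cq * tr)"
    by (simp add: algebra_simps power2_eq_square)
  \<comment> \<open>By \<open>F\<close> the bracket is \<open>d * y0\<close>, so \<open>d\<close>
    divides every summand.\<close>
  also have "\<dots> = d * ?R"
    unfolding F[symmetric] by (simp add: algebra_simps)
  finally show ?thesis
    using \<open>d \<noteq> 0\<close> by simp
qed

section \<open>Specializations, shifts and the first 2n terms\<close>

locale gale_robinson =
  fixes p q r n :: nat and y :: "nat \<Rightarrow> ratfun"
  assumes pos: "p > 0" "q > 0" "r > 0" and pq: "p \<noteq> q" and n: "n = p + q + r"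
    and init: "\<And>i. i < n \<Longrightarrow> y i = Y i"
    and rec: "\<And>k. y (k + n) =
           (\<alpha> * y (k + p) * y (k + n - p)
            + \<beta> * y (k + q) * y (k + n - q)
            + \<gamma> * y (k + r) * y (k + n - r)) / y k"
begin

text \<open>The bound \<open>M\<close> allows \<open>z\<close> to meet a division by zero later on:
  \<open>linear_point\<close> stops just before index \<open>2 * n\<close>.\<close>

lemma specializes_sequence:
  assumes H: "is_ring_hom H"
    and abc: "specializes H \<alpha> a" "specializes H \<beta> b" "specializes H \<gamma> c"
    and init_H: "\<And>i. i < n \<Longrightarrow> specializes H (Y i) (z i)"
    and nz: "\<And>k. k + n < M \<Longrightarrow> z k \<noteq> 0"
    and rec_z: "\<And>k. k + n < M \<Longrightarrow> z (k + n) =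
       (a * z (k + p) * z (k + n - p) + b * z (k + q) * z (k + n - q)
        + c * z (k + r) * z (k + n - r)) / z k"
  shows "m < M \<Longrightarrow> specializes H (y m) (z m)"
proof (induction m rule: less_induct)
  case (less m)
  show ?case
  proof (cases "m < n")
    case True
    then show ?thesis using init init_H by simp
  next
    case False
    then obtain k where m: "m = k + n"
      by (metis add.commute le_Suc_ex not_less)
    with less.prems have k: "k + n < M" by simp
    have IH: "specializes H (y j) (z j)" if "j < k + n" for j
      using less that m by simp
    show ?thesis
      unfolding m rec rec_z[OF k]
      using pos n by (intro specializes_intros H abc IH nz k) auto
  qed
qed

text \<open>The recurrence is free of subtraction: with all parameters and initial terms equal to 1
  every value is positive, whereas 0 has the value 0.\<close>

lemma y_nonzero: "y m \<noteq> 0"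
proof -
  obtain H :: "poly_ring \<Rightarrow> rat" where H: "is_ring_hom H"
    and abc: "specializes H \<alpha> 1" "specializes H \<beta> 1" "specializes H \<gamma> 1"
    and Y1: "\<And>i. specializes H (Y i) 1"
    by (rule ring_hom_point[of 1 1 1 "\<lambda>_. 1"], rule that)
  have "\<exists>v>0. specializes H (y m) v"
  proof (induction m rule: less_induct)
    case (less m)
    show ?case
    proof (cases "m < n")
      case True
      then show ?thesis using init Y1[of m] by (intro exI[of _ 1]) simp
    next
      case False
      then obtain k where m: "m = k + n"
        by (metis add.commute le_Suc_ex not_less)
      then have "\<forall>j. \<exists>v. j < k + n \<longrightarrow> v > 0 \<and> specializes H (y j) v"
        using less by blast
      then obtain z where z: "\<And>j. j < k + n \<Longrightarrow> z j > 0"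
        and spec: "\<And>j. j < k + n \<Longrightarrow> specializes H (y j) (z j)"
        by metis
      let ?v = "(1 * z (k + p) * z (k + n - p) + 1 * z (k + q) * z (k + n - q)
        + 1 * z (k + r) * z (k + n - r)) / z k"
      have "?v > 0"
        using pos n by (intro divide_pos_pos add_pos_pos mult_pos_pos z) auto
      moreover have "specializes H (y m) ?v"
        unfolding m rec using pos n z[of k]
        by (intro specializes_intros H abc spec) auto
      ultimately show ?thesis by blast
    qed
  qed
  then obtain v where "v > 0" "specializes H (y m) v" by blast
  moreover have "specializes H 0 0"
    using specializes_diff[OF H specializes_one[OF H] specializes_one[OF H]] by simp
  ultimately show ?thesis
    using specializes_unique[OF H, of 0 0 v] by auto
qed

lemma rec_mult: "y (k + n) * y k =
    \<alpha> * y (k + p) * y (k + n - p) + \<beta> * y (k + q) * y (k + n - q)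
    + \<gamma> * y (k + r) * y (k + n - r)"
  using rec[of k] y_nonzero[of k] by simp

definition shift_gens :: "nat \<Rightarrow> ratfun set" where
  "shift_gens s = {\<alpha>, \<beta>, \<gamma>} \<union> (\<lambda>i. y (i + s)) ` {..<n} \<union> (\<lambda>i. inverse (y (i + s))) ` {..<n}"

text \<open>The recurrence is invariant under index shifts, so substituting \<open>y (i + s)\<close>
  for \<open>Y i\<close> turns \<open>y m\<close> into \<open>y (m + s)\<close> and a Laurent
  expression into one in the shifted variables.\<close>

lemma shift_mem:
  assumes "y m \<in> laurent_ring {..<n}"
  shows "y (m + s) \<in> ring_gen (shift_gens s)"
proof -
  obtain H :: "poly_ring \<Rightarrow> ratfun" where H: "is_ring_hom H"
    and abc: "specializes H \<alpha> \<alpha>" "specializes H \<beta> \<beta>" "specializes H \<gamma> \<gamma>"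
    and Yi: "\<And>i. specializes H (Y i) (y (i + s))"
    by (rule ring_hom_point[of \<alpha> \<beta> \<gamma> "\<lambda>i. y (i + s)"], rule that)
  have "y (k + n + s) =
       (\<alpha> * y (k + p + s) * y (k + n - p + s) + \<beta> * y (k + q + s) * y (k + n - q + s)
        + \<gamma> * y (k + r + s) * y (k + n - r + s)) / y (k + s)" for k
    using rec[of "k + s"] n by (simp add: ac_simps)
  then have spec: "specializes H (y m) (y (m + s))"
    by (intro specializes_sequence[where M = "Suc m" and z = "\<lambda>i. y (i + s)", OF H abc])
       (use Yi y_nonzero in auto)
  have "\<exists>v\<in>ring_gen (shift_gens s). specializes H g v" if "g \<in> laurent_gens {..<n}" for g
  proof -
    from that consider "g \<in> {\<alpha>, \<beta>, \<gamma>}" | i where "i < n" "g = Y i" | i where "i < n" "g = inverse (Y i)"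
      by (auto simp: laurent_gens_def)
    then show ?thesis
    proof cases
      case 1
      then show ?thesis using abc by (auto simp: shift_gens_def intro: ring_gen.gen)
    next
      case 2
      then show ?thesis using Yi by (auto simp: shift_gens_def intro: ring_gen.gen)
    next
      case 3
      then show ?thesis
        using specializes_inverse[OF Yi y_nonzero, of i]
        by (auto simp: shift_gens_def intro!: ring_gen.gen bexI)
    qed
  qed
  from specializes_ring_gen[OF H assms this] show ?thesis
    using specializes_unique[OF H spec] by blast
qed

text \<open>Up to this index the recurrence divides only by initial variables.\<close>

lemma y_mem_below_2n:
  assumes "m < 2 * n"
  shows "y m \<in> laurent_ring {..<n}"
  using assms
proof (induction m rule: less_induct)
  case (less m)
  show ?case
  proof (cases "m < n")
    case True
    then show ?thesis using init laurent_gens_mem by simp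
  next
    case False
    then obtain k where m: "m = k + n"
      by (metis add.commute le_Suc_ex not_less)
    with less.prems have k: "k < n" by simp
    have IH: "y j \<in> laurent_ring {..<n}" if "j < k + n" for j
      using less that m by simp
    show ?thesis
      unfolding m rec divide_inverse init[OF k]
      using pos n k by (intro ring_gen_intros laurent_gens_mem IH) auto
  qed
qed

section \<open>Primality of y_n\<close>

lemma y_n: "y n * Y 0 = \<alpha> * Y p * Y (n - p) + \<beta> * Y q * Y (n - q) + \<gamma> * Y r * Y (n - r)"
  using rec_mult[of 0] pos n by (simp add: init)

text \<open>The point \<open>H\<close> keeps every variable except \<open>\<alpha>\<close>, which is replaced by the solution of
  \<open>y n = 0\<close>.\<close>

lemma reduction_mod_y_n:
  obtains H :: "poly_ring \<Rightarrow> ratfun" where "is_ring_hom H" and "specializes H (y n) 0"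
    and "\<And>I f. {..<n} \<subseteq> I \<Longrightarrow> f \<in> laurent_ring I \<Longrightarrow>
           \<exists>g\<in>laurent_ring I. specializes H f (f - y n * g)"
proof -
  \<comment> \<open>The coefficient of \<alpha> in \<open>y n\<close> is the unit
    \<open>Y p * Y (n - p) / Y 0\<close>, with inverse \<open>g0\<close>; replacing \<alpha> by
    \<open>\<alpha> - y n * g0\<close> therefore sends \<open>y n\<close> to 0.\<close>
  define g0 where "g0 = Y 0 * inverse (Y p) * inverse (Y (n - p))"
  obtain H :: "poly_ring \<Rightarrow> ratfun" where H: "is_ring_hom H"
    and abc: "specializes H \<alpha> (\<alpha> - y n * g0)" "specializes H \<beta> \<beta>" "specializes H \<gamma> \<gamma>"
    and Yi: "\<And>i. specializes H (Y i) (Y i)"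
    by (rule ring_hom_point[of "\<alpha> - y n * g0" \<beta> \<gamma> Y], rule that)
  have "(\<alpha> - y n * g0) * Y p * Y (n - p) = \<alpha> * Y p * Y (n - p) - y n * Y 0"
    by (simp add: g0_def Y_nonzero algebra_simps)
  then have 0: "((\<alpha> - y n * g0) * Y p * Y (n - p) + \<beta> * Y q * Y (n - q) + \<gamma> * Y r * Y (n - r)) / Y 0 = 0"
    unfolding y_n by simp
  have "specializes H ((\<alpha> * Y p * Y (n - p) + \<beta> * Y q * Y (n - q) + \<gamma> * Y r * Y (n - r)) / Y 0)
      (((\<alpha> - y n * g0) * Y p * Y (n - p) + \<beta> * Y q * Y (n - q) + \<gamma> * Y r * Y (n - r)) / Y 0)"
    by (intro specializes_intros H abc Yi Y_nonzero)
  moreover have "y n = (\<alpha> * Y p * Y (n - p) + \<beta> * Y q * Y (n - q) + \<gamma> * Y r * Y (n - r)) / Y 0"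
    using y_n Y_nonzero by (simp add: eq_divide_eq)
  ultimately have y_n_0: "specializes H (y n) 0"
    unfolding 0 by (simp only:)
  \<comment> \<open>The substitution is the identity modulo \<open>y n\<close>. Among the generators
    only \<alpha> moves, with cofactor \<open>g0\<close>; sums and products preserve the
    congruence.\<close>
  have "\<exists>g\<in>laurent_ring I. specializes H f (f - y n * g)"
    if I: "{..<n} \<subseteq> I" and f: "f \<in> laurent_ring I" for I f
  proof -
    have y_n_mem: "y n \<in> laurent_ring I"
    proof -
      have "laurent_gens {..<n} \<subseteq> laurent_gens I"
        using I by (auto simp: laurent_gens_def)
      then show ?thesis using ring_gen_mono y_mem_below_2n[of n] pos n by simp
    qed
    show ?thesis
      using f
    proof induction
      case one
      then show ?case
        using specializes_one[OF H] ring_gen_zero by (intro bexI[of _ 0]) auto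
    next
      case minus_one
      then show ?case
        using specializes_minus[OF H specializes_one[OF H]] ring_gen_zero
        by (intro bexI[of _ 0]) auto
    next
      case (gen g)
      have "g0 \<in> laurent_ring I"
        unfolding g0_def using I pos n by (intro ring_gen_intros laurent_gens_mem) auto
      moreover have "specializes H (inverse (Y i)) (inverse (Y i))" for i
        by (rule specializes_inverse[OF Yi Y_nonzero])
      ultimately show ?case
        using gen abc Yi ring_gen_zero[of "laurent_gens I"]
        by (auto simp: laurent_gens_def intro: bexI[of _ g0] bexI[of _ 0])
    next
      case (add f f')
      then obtain g g' where g: "g \<in> laurent_ring I" "specializes H f (f - y n * g)"
        and g': "g' \<in> laurent_ring I" "specializes H f' (f' - y n * g')"
        by blast
      have "(f - y n * g) + (f' - y n * g') = (f + f') - y n * (g + g')"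
        by (simp add: algebra_simps)
      with specializes_add[OF H g(2) g'(2)] show ?case
        using ring_gen.add[OF g(1) g'(1)] by (intro bexI[of _ "g + g'"]) auto
    next
      case (mult f f')
      then obtain g g' where g: "g \<in> laurent_ring I" "specializes H f (f - y n * g)"
        and g': "g' \<in> laurent_ring I" "specializes H f' (f' - y n * g')"
        by blast
      let ?g = "g * f' + f * g' - y n * g * g'"
      have "(f - y n * g) * (f' - y n * g') = f * f' - y n * ?g"
        by (simp add: algebra_simps)
      with specializes_mult[OF H g(2) g'(2)] have "specializes H (f * f') (f * f' - y n * ?g)"
        by simp
      moreover have "?g \<in> laurent_ring I"
        by (intro ring_gen_intros g g' mult y_n_mem)
      ultimately show ?case by blast
    qed
  qed
  with H y_n_0 show thesis by (rule that)
qed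

text \<open>Write \<open>f = P / B\<close> with \<open>B\<close> nonzero at \<open>H\<close>.
  Applying the reduction to \<open>f * y n * B = P * y n\<close> gives 0, so \<open>y n\<close>
  divides \<open>f * y n\<close> with a Laurent cofactor, as desired, or it divides
  \<open>B\<close>.\<close>

lemma cancel_y_n:
  assumes H: "is_ring_hom H" and H_y_n: "specializes H (y n) 0"
    and regular: "\<And>g. g \<in> laurent_ring UNIV \<Longrightarrow> \<exists>w. specializes H g w"
    and f: "specializes H f v" and mem: "f * y n \<in> laurent_ring {..<n}"
  shows "f \<in> laurent_ring {..<n}"
proof -
  obtain \<psi> :: "poly_ring \<Rightarrow> ratfun" where \<psi>: "is_ring_hom \<psi>" "specializes \<psi> (y n) 0"
    and red: "\<And>I f. {..<n} \<subseteq> I \<Longrightarrow> f \<in> laurent_ring I \<Longrightarrow>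
           \<exists>g\<in>laurent_ring I. specializes \<psi> f (f - y n * g)"
    by (rule reduction_mod_y_n, rule that)
  obtain P B where PB: "f = Fract P B" "H B \<noteq> 0"
    using f by (auto simp: specializes_def)
  then have "B \<noteq> 0"
    using is_ring_homD(1)[OF H] by auto
  obtain g where g: "g \<in> laurent_ring {..<n}" "specializes \<psi> (f * y n) (f * y n - y n * g)"
    using red[OF _ mem] by auto
  obtain g' where g': "g' \<in> laurent_ring UNIV"
    "specializes \<psi> (Fract B 1) (Fract B 1 - y n * g')"
    using red[OF _ Fract_mem_laurent_ring] by auto
  have "f * Fract B 1 = Fract P 1"
    using \<open>B \<noteq> 0\<close> by (simp add: PB(1) eq_fract)
  then have "f * y n * Fract B 1 = Fract P 1 * y n"
    by (simp add: mult_ac)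
  then have "specializes \<psi> (f * y n * Fract B 1) (\<psi> P * 0)"
    by (simp only:) (intro specializes_intros \<psi> specializes_Fract_1)
  moreover have "specializes \<psi> (f * y n * Fract B 1) ((f * y n - y n * g) * (Fract B 1 - y n * g'))"
    by (intro specializes_intros \<psi> g g')
  ultimately have "\<psi> P * 0 = (f * y n - y n * g) * (Fract B 1 - y n * g')"
    by (rule specializes_unique[OF \<psi>(1)])
  then have "f * y n = y n * g \<or> Fract B 1 = y n * g'"
    by simp
  moreover have "Fract B 1 \<noteq> y n * g'"
  proof
    \<comment> \<open>A multiple of \<open>y n\<close> by an element regular at \<open>H\<close>
      vanishes there, but \<open>B\<close> does not.\<close>
    assume eq: "Fract B 1 = y n * g'"
    obtain w where "specializes H g' w"
      using regular[OF g'(1)] by blast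
    then have "specializes H (Fract B 1) (0 * w)"
      unfolding eq by (intro specializes_intros H H_y_n)
    from specializes_unique[OF H this specializes_Fract_1[OF H]] PB(2) show False
      by simp
  qed
  ultimately have "f = g"
    using y_nonzero[of n] by simp
  with g show ?thesis by simp
qed

section \<open>Singularity confinement and a point with y_n = 0\<close>

text \<open>The only divisor left for \<open>y (n + n)\<close> is a product of initial variables.
  The instances of the recurrence used are those at 0 (for \<open>F\<close>), at p, q, r, at their
  complements n-p, n-q, n-r, and at n.\<close>

lemma y_2n: "y (n + n) * (y (q + r) * y (p + r) * y (p + q)) =
    y (p + n) * y (q + n) * y (r + n) * y 0
    + \<alpha>\<^sup>2 * (y (p + n) * y (p + r) * y (p + q) * y (q + r + q + r) - y (q + n) * y (r + n) * y (q + r) * y (p + p))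
    + \<beta>\<^sup>2 * (y (q + n) * y (q + r) * y (p + q) * y (p + r + p + r) - y (p + n) * y (r + n) * y (p + r) * y (q + q))
    + \<gamma>\<^sup>2 * (y (r + n) * y (q + r) * y (p + r) * y (p + q + p + q) - y (p + n) * y (q + n) * y (p + q) * y (r + r))"
proof -
  \<comment> \<open>Writing out \<open>n\<close> removes the natural-number subtractions, so indices
    can be matched by commutativity.\<close>
  have rec': "y (k + p + q + r) * y k = \<alpha> * y (k + p) * y (k + q + r)
     + \<beta> * y (k + q) * y (k + p + r) + \<gamma> * y (k + r) * y (k + p + q)" for k
    using rec_mult[of k] by (simp add: n add.assoc add.left_commute[of q])
  show ?thesis
    by (rule confinement_identity[where d = "y n" and bp = "y p" and bq = "y q" and br = "y r"
          and upq = "y (p + p + r)" and upr = "y (p + p + q)" and uqp = "y (q + q + r)"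
          and uqr = "y (q + q + p)" and urp = "y (r + r + q)" and urq = "y (r + r + p)"
          and Cp = "y (q + r + n)" and Cq = "y (p + r + n)" and Cr = "y (p + q + n)"])
       (use y_nonzero rec'[of 0] rec'[of p] rec'[of q] rec'[of r] rec'[of "q + r"] rec'[of "p + r"]
          rec'[of "p + q"] rec'[of n] in \<open>simp_all add: n ac_simps\<close>)
qed

text \<open>For these \<open>a\<close> and \<open>b\<close>, and with \<open>\<gamma>\<close> set to \<open>0\<close>, the recurrence is solved by
  \<open>z m = m - n\<close>, which vanishes only at \<open>m = n\<close>. At \<open>2 * n\<close> the recurrence reads \<open>0 / 0\<close> at this point,
  hence the appeal to \<open>y_2n\<close>.\<close>

lemma linear_point:
  obtains H :: "poly_ring \<Rightarrow> rat" where "is_ring_hom H" and "specializes H (y n) 0"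
    and "\<And>g. g \<in> laurent_ring UNIV \<Longrightarrow> \<exists>w. specializes H g w"
    and "\<And>g. g \<in> ring_gen (shift_gens (n + 1)) \<Longrightarrow> \<exists>w. specializes H g w"
proof -
  define P Q R :: rat where PQR_def: "P = of_nat p" "Q = of_nat q" "R = of_nat r"
  have PQR: "P > 0" "Q > 0" "R > 0" "P \<noteq> Q"
    using pos pq by (simp_all add: PQR_def)
  \<comment> \<open>Comparing coefficients of K in the recurrence for \<open>z\<close> leaves a + b
    = 1 and a P (Q + R) + b Q (P + R) = 0. This is the solution; its denominator is nonzero because
    p and q differ.\<close>
  define a b where "a = Q * (P + R) / ((Q - P) * R)" and "b = - P * (Q + R) / ((Q - P) * R)"
  define z :: "nat \<Rightarrow> rat" where "z m = of_nat m - of_nat n" for m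
  have nz: "z m \<noteq> 0" if "m \<noteq> n" for m
    using that by (simp add: z_def)
  obtain H :: "poly_ring \<Rightarrow> rat" where H: "is_ring_hom H"
    and abc: "specializes H \<alpha> a" "specializes H \<beta> b" "specializes H \<gamma> 0"
    \<comment> \<open>The variables from \<open>Y n\<close> on do not enter the sequence. They get
      the value 1, as \<open>z n = 0\<close> would make the inverse of \<open>Y n\<close>
      irregular.\<close>
    and Yi: "\<And>i. specializes H (Y i) (if i < n then z i else 1)"
    by (rule ring_hom_point[of a b 0 "\<lambda>i. if i < n then z i else 1"], rule that)
  have spec: "specializes H (y m) (z m)" if "m < 2 * n" for m
  proof (rule specializes_sequence[OF H abc _ _ _ that])
    show "specializes H (Y i) (z i)" if "i < n" for i
      using Yi[of i] that by simp
    fix k assume "k + n < 2 * n"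
    then show "z k \<noteq> 0"
      using nz by simp
    define K :: rat where "K = of_nat k"
    have z: "z k = K - P - Q - R" "z (k + n) = K" "z (k + p) = K - Q - R" "z (k + n - p) = K - P"
      "z (k + q) = K - P - R" "z (k + n - q) = K - Q"
      by (simp_all add: z_def K_def PQR_def n of_nat_diff)
    have ab: "a * ((Q - P) * R) = Q * (P + R)" "b * ((Q - P) * R) = - P * (Q + R)"
      using PQR by (simp_all add: a_def b_def)
    have "(a * ((K - Q - R) * (K - P)) + b * ((K - P - R) * (K - Q))) * ((Q - P) * R)
        = (a * ((Q - P) * R)) * ((K - Q - R) * (K - P)) + (b * ((Q - P) * R)) * ((K - P - R) * (K - Q))"
      by (simp add: algebra_simps)
    also have "\<dots> = K * (K - P - Q - R) * ((Q - P) * R)"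
      unfolding ab by (simp add: algebra_simps)
    finally have "a * ((K - Q - R) * (K - P)) + b * ((K - P - R) * (K - Q)) = K * (K - P - Q - R)"
      using PQR by simp
    then show "z (k + n) = (a * z (k + p) * z (k + n - p) + b * z (k + q) * z (k + n - q)
        + 0 * z (k + r) * z (k + n - r)) / z k"
      using \<open>z k \<noteq> 0\<close> by (simp add: z eq_divide_eq mult.assoc)
  qed
  have y_n_0: "specializes H (y n) 0"
    using spec[of n] pos n by (simp add: z_def)
  have gens: "\<exists>w\<in>ring_gen UNIV. specializes H g w"
    if "g \<in> {\<alpha>, \<beta>, \<gamma>} \<union> u ` I \<union> (\<lambda>i. inverse (u i)) ` I"
      and u: "\<And>i. i \<in> I \<Longrightarrow> \<exists>w. specializes H (u i) w \<and> w \<noteq> 0" for g u and I :: "nat set"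
    using that abc by (auto intro: ring_gen.gen dest!: u intro: specializes_inverse)
  have "\<exists>w. specializes H g w" if "g \<in> laurent_ring UNIV" for g
  proof -
    have "\<exists>w. specializes H (Y i) w \<and> w \<noteq> 0" for i
      using Yi[of i] nz by (metis less_irrefl one_neq_zero)
    then have "\<exists>w\<in>ring_gen UNIV. specializes H g w"
      using specializes_ring_gen[OF H that[unfolded laurent_gens_def] gens] by simp
    then show ?thesis by blast
  qed
  moreover have "\<exists>w. specializes H g w" if "g \<in> ring_gen (shift_gens (n + 1))" for g
  proof -
    have y_2n_spec: "\<exists>w. specializes H (y (n + n)) w \<and> w \<noteq> 0"
    proof -
      let ?N = "\<lambda>a b c u. u (p + n) * u (q + n) * u (r + n) * u 0
        + a\<^sup>2 * (u (p + n) * u (p + r) * u (p + q) * u (q + r + q + r) - u (q + n) * u (r + n) * u (q + r) * u (p + p))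
        + b\<^sup>2 * (u (q + n) * u (q + r) * u (p + q) * u (p + r + p + r) - u (p + n) * u (r + n) * u (p + r) * u (q + q))
        + c\<^sup>2 * (u (r + n) * u (q + r) * u (p + r) * u (p + q + p + q) - u (p + n) * u (q + n) * u (p + q) * u (r + r))"
      let ?D = "\<lambda>u. u (q + r) * u (p + r) * u (p + q)"
      have D: "?D z \<noteq> 0"
        using pos n nz by simp
      have "y (n + n) = ?N \<alpha> \<beta> \<gamma> y / ?D y"
        using y_2n y_nonzero by (simp add: eq_divide_eq)
      moreover have "specializes H (?N \<alpha> \<beta> \<gamma> y / ?D y) (?N a b 0 z / ?D z)"
        by (intro specializes_intros H abc spec D) (use pos n in auto)
      moreover have "?N a b 0 z / ?D z \<noteq> 0"
      proof -
        have z: "z (p + n) = P" "z (q + n) = Q" "z (r + n) = R" "z 0 = - (P + Q + R)"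
          "z (p + r) = - Q" "z (p + q) = - R" "z (q + r) = - P" "z (q + r + q + r) = Q + R - P"
          "z (p + r + p + r) = P + R - Q" "z (p + p) = P - Q - R" "z (q + q) = Q - P - R"
          by (simp_all add: z_def PQR_def n)
        \<comment> \<open>The brackets after the squares of \<open>a\<close> and \<open>b\<close>
          vanish. As \<open>?D z\<close> is -PQR, the quotient is P + Q + R =
          \<open>z (2 * n)\<close>: the linear solution continues past 0/0.\<close>
        have "?N a b 0 z = - (P * Q * R * (P + Q + R))"
          unfolding z by (simp add: algebra_simps)
        moreover have "P * Q * R * (P + Q + R) > 0"
          using PQR by simp
        ultimately show ?thesis using D by auto
      qed
      ultimately show ?thesis by metis
    qed
    \<comment> \<open>The indices run from n+1 to 2n; \<open>spec\<close> covers all of them but the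
      last.\<close>
    have shifted: "\<exists>w. specializes H (y (i + (n + 1))) w \<and> w \<noteq> 0" if "i < n" for i
    proof (cases "i + 1 = n")
      case True
      then have "i + (n + 1) = n + n" by simp
      then show ?thesis using y_2n_spec by (simp only:)
    next
      case False
      with that have "specializes H (y (i + (n + 1))) (z (i + (n + 1)))"
        by (intro spec) simp
      moreover have "z (i + (n + 1)) \<noteq> 0"
        by (rule nz) simp
      ultimately show ?thesis by blast
    qed
    have "\<exists>w\<in>ring_gen UNIV. specializes H g w"
    proof (rule specializes_ring_gen[OF H that])
      fix g assume g: "g \<in> shift_gens (n + 1)"
      show "\<exists>w\<in>ring_gen UNIV. specializes H g w"
      proof (rule gens)
        show "g \<in> {\<alpha>, \<beta>, \<gamma>} \<union> (\<lambda>i. y (i + (n + 1))) ` {..<n}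
            \<union> (\<lambda>i. inverse (y (i + (n + 1)))) ` {..<n}"
          using g unfolding shift_gens_def .
      next
        fix i assume "i \<in> {..<n}"
        then show "\<exists>w. specializes H (y (i + (n + 1))) w \<and> w \<noteq> 0"
          using shifted by blast
      qed
    qed
    then show ?thesis by blast
  qed
  ultimately show thesis
    using H y_n_0 that by blast
qed

section \<open>Removing the powers of y_n\<close>

text \<open>Of y_1, ..., y_n only the last is not an initial variable, so its inverse is the only
  new generator.\<close>

lemma shift_1_denominator:
  assumes "f \<in> ring_gen (shift_gens 1)"
  shows "\<exists>k. f * y n ^ k \<in> laurent_ring {..<n}"
proof -
  have y_n_mem: "y n \<in> laurent_ring {..<n}"
    using y_mem_below_2n[of n] pos n by simp
  from assms show ?thesis
  proof induction
    case (gen g)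
    then consider "g \<in> {\<alpha>, \<beta>, \<gamma>}" | i where "i < n" "g = y (i + 1)"
      | i where "i < n" "g = inverse (y (i + 1))"
      by (auto simp: shift_gens_def)
    then show ?case
    proof cases
      case 1
      then show ?thesis using laurent_gens_mem by (intro exI[of _ 0]) auto
    next
      case 2
      then show ?thesis using y_mem_below_2n[of "i + 1"] n pos by (intro exI[of _ 0]) simp
    next
      case 3
      show ?thesis
      proof (cases "i + 1 = n")
        case True
        then show ?thesis
          using 3 y_nonzero[of n] ring_gen.one by (intro exI[of _ 1]) simp
      next
        case False
        then show ?thesis
          using 3 init[of "i + 1"] laurent_gens_mem(5)[of "i + 1" "{..<n}"]
          by (intro exI[of _ 0]) simp
      qed
    qed
  next
    case (add f g)
    then obtain k l where "f * y n ^ k \<in> laurent_ring {..<n}" "g * y n ^ l \<in> laurent_ring {..<n}"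
      by blast
    then have "(f * y n ^ k) * y n ^ l + (g * y n ^ l) * y n ^ k \<in> laurent_ring {..<n}"
      by (intro ring_gen.add ring_gen.mult[where f = "f * _"] ring_gen.mult[where f = "g * _"]
          ring_gen_power y_n_mem)
    then show ?case
      by (intro exI[of _ "k + l"]) (simp add: algebra_simps power_add)
  next
    case (mult f g)
    then obtain k l where "f * y n ^ k \<in> laurent_ring {..<n}" "g * y n ^ l \<in> laurent_ring {..<n}"
      by blast
    then have "(f * y n ^ k) * (g * y n ^ l) \<in> laurent_ring {..<n}"
      by (rule ring_gen.mult)
    then show ?case
      by (intro exI[of _ "k + l"]) (simp add: algebra_simps power_add)
  next
    case one
    show ?case by (rule exI[of _ 0]) (simp add: ring_gen.one)
  next
    case minus_one
    show ?case by (rule exI[of _ 0]) (simp add: ring_gen.minus_one)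
  qed
qed

lemma y_mem_laurent_ring: "y m \<in> laurent_ring {..<n}"
proof (induction m rule: less_induct)
  case (less m)
  show ?case
  proof (cases "m < 2 * n")
    case True
    then show ?thesis by (rule y_mem_below_2n)
  next
    case False
    \<comment> \<open>The induction hypothesis is used at \<open>m - 1\<close>, shifted by 1, to
      bound the denominator, and at \<open>m - (n + 1)\<close>, shifted by \<open>n + 1\<close>, to
      get a value at \<open>H\<close>.\<close>
    then have m: "m \<ge> n + 1" "m - 1 < m" "m - (n + 1) < m"
      using pos n by auto
    obtain k where k: "y m * y n ^ k \<in> laurent_ring {..<n}"
      using shift_1_denominator[OF shift_mem[OF less[OF m(2)], of 1]] m by auto
    obtain H :: "poly_ring \<Rightarrow> rat" where H: "is_ring_hom H" "specializes H (y n) 0"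
      and reg: "\<And>g. g \<in> laurent_ring UNIV \<Longrightarrow> \<exists>w. specializes H g w"
        "\<And>g. g \<in> ring_gen (shift_gens (n + 1)) \<Longrightarrow> \<exists>w. specializes H g w"
      by (rule linear_point, rule that)
    obtain v where v: "specializes H (y m) v"
      using reg(2)[OF shift_mem[OF less[OF m(3)], of "n + 1"]] m by auto
    from k show ?thesis
    proof (induction k)
      case (Suc k)
      then have "y m * y n ^ k * y n \<in> laurent_ring {..<n}"
        by (simp add: mult_ac)
      \<comment> \<open>Cancelling one factor at a time only requires the remaining product to be
        regular at \<open>H\<close>, whatever its value.\<close>
      moreover have "specializes H (y m * y n ^ k) (v * 0 ^ k)"
        by (intro specializes_intros H v)
      ultimately have "y m * y n ^ k \<in> laurent_ring {..<n}"
        using cancel_y_n[OF H reg(1)] by blast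
      then show ?case by (rule Suc.IH)
    qed simp
  qed
qed

end

theorem theorem1p4:
  fixes p q r n :: nat and y :: "nat \<Rightarrow> ratfun"
  assumes "p > 0" and "q > 0" and "r > 0"
    and "p \<noteq> q" and "p \<noteq> r" and "q \<noteq> r"
    and "n = p + q + r"
    and "\<And>i. i < n \<Longrightarrow> y i = Y i"
    and "\<And>k. y (k + n) =
           (\<alpha> * y (k + p) * y (k + n - p)
            + \<beta> * y (k + q) * y (k + n - q)
            + \<gamma> * y (k + r) * y (k + n - r)) / y k"
  shows "\<forall>m. laurent_polynomial n (y m)"
proof -
  interpret gale_robinson p q r n y
    by unfold_locales (fact assms)+
  show ?thesis
    using y_mem_laurent_ring laurent_ring_imp_laurent_polynomial by blast
qed

end
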